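(* Consider the finite-dimensional problem data and the ADMM algorithm with funnel-type penalty update described in the context, with parameters $\gamma>1$, $c>1$, $\beta,\zeta\in(0,1)$, $\rho^{(0)}>0$. Let $\{v^{(j)}\}$, $\{w^{(j)}\}$, $\{\lambda^{(j)}\}$, $\{\rho^{(j)}\}$, $\{\tau^{(j)}\}$, $j\in\mathbb{N}$, be infinite sequences generated by this algorithm, and let $\mathcal{L}^{(j)}:=\mathcal{L}_{\rho^{(j)}}(v^{(j)},w^{(j)},\lambda^{(j)})$. Assume: (i) (block Lipschitz continuity) for fixed $\bar w,\bar\lambda$ and $\rho$, the map $v\mapsto\mathcal{L}_\rho(v,\bar w,\bar\lambda)$ is continuously differentiable over $\mathbb{R}^{|E|}$, and there is $L_v>0$ such that for all $j$ $$|\mathcal{L}_{\rho^{(j)}}(v^{(j+1)},w^{(j)},\lambda^{(j)})-\mathcal{L}_{\rho^{(j)}}(v^{(j)},w^{(j)},\lambda^{(j)})|\le L_v\|v^{(j+1)}-v^{(j)}\|;$$ (ii) the sequence $\{\mathcal{L}^{(j)}\}$ is bounded below; (iii) $\|w^{(j+n)}-v^{(j+n)}\|_2^2\le\beta\,\tau^{(j)}$ for all $j,n\in\mathbb{N}$. Then one of the following holds: either the penalty parameters are bounded above, i.e. there is $\bar\rho<+\infty$ with $\rho^{(j)}\le\bar\rho$ for all $j$; or $\rho^{(j)}\to+\infty$ as $j\to+\infty$. In both cases, $$\|w^{(j)}-v^{(j)}\|_2^2\to 0\quad\text{as } j\to+\infty .$$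
   Context: **Problem data.** $E$ is a finite set (of finite elements); for $e\in E$, $\mathcal{N}(e)\subseteq E$ is the set of elements adjacent to $e$, and $s_{ee'}\in\{1,\sqrt2\}$ are edge weights. $\alpha>0$ is a regularization parameter and $V_{\max}$ a volume fraction. The discretized state equation is $A(v)u+f=0$, a finite element discretization (boundary conditions included) of $\nabla\cdot(k(v)\nabla u)+\mathcal{F}=0$ in a domain $\Omega$, with $u=0$ on the Dirichlet part of the boundary and zero flux on the Neumann part; the control $v=(v_e)_{e\in E}$ is constant on each element and enters through the conductivity $k(v_e)=\kappa+(1-\kappa)v_e^p$ on element $e$, with $\kappa\in(0,1)$, $p\ge1$. Here $f$ is the fixed load vector, the matrix $A(v)$ is nonsingular, and $u(v)$ denotes the unique solution of $A(v)u+f=0$. Put $$\phi(v)=f^Tu(v),\qquad \psi(w)=\alpha\sum_{e\in E}\sum_{e'\in\mathcal{N}(e)}|w_e-w_{e'}|\,s_{ee'} .$$ **Augmented Lagrangian.** For $\rho>0$ and $v,w,\lambda\in\mathbb{R}^{|E|}$, $$\mathcal{L}_\rho(v,w,\lambda)=\phi(v)+\psi(w)+\lambda^T(w-v)+\frac{\rho}{2}\|w-v\|_2^2 .$$ **Feasible sets.** $\mathcal{V}=\{v\in[0,1]^{|E|}:\sum_{e}v_e\le V_{\max}|E|\}$ and $\mathcal{W}=\{w\in\{0,1\}^{|E|}:\sum_e w_e\le V_{\max}|E|\}$. **Algorithm.** Initialize $v^{(0)}\in\mathcal{V}$, $w^{(0)}\in\mathcal{W}$, $\lambda^{(0)}\in\mathbb{R}^{|E|}$,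 $\rho^{(0)}>0$, and $\tau^{(0)}=\gamma\max(1,\|w^{(0)}-v^{(0)}\|_2^2)$. For $j=0,1,2,\dots$ (run without termination): 1. Continuous subproblem: $v^*\in\arg\min_{v\in\mathcal{V}}\mathcal{L}_{\rho^{(j)}}(v,w^{(j)},\lambda^{(j)})$. 2. Discrete subproblem: $w^*\in\arg\min_{w\in\mathcal{W}}\mathcal{L}_{\rho^{(j)}}(v^*,w,\lambda^{(j)})$. 3. If $\|w^*-v^*\|_2^2\le\beta\tau^{(j)}$ (accept): set $v^{(j+1)}=v^*$, $w^{(j+1)}=w^*$, $\tau^{(j+1)}=(1-\zeta)\tau^{(j)}+\zeta\|w^{(j+1)}-v^{(j+1)}\|_2^2$, $\lambda^{(j+1)}=\lambda^{(j)}+\rho^{(j)}(w^{(j+1)}-v^{(j+1)})$, $\rho^{(j+1)}=\rho^{(j)}$. 4. Otherwise (reject): set $v^{(j+1)}=v^{(j)}$, $w^{(j+1)}=w^{(j)}$, $\tau^{(j+1)}=\tau^{(j)}$, $\lambda^{(j+1)}=\lambda^{(j)}$, $\rho^{(j+1)}=c\,\rho^{(j)}$. *)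

theory Defs
  imports "HOL-Analysis.Analysis"
begin

text \<open>
  The elements are indexed by the finite type \<open>'e\<close>, so that controls live in \<^typ>\<open>real^'e\<close>;
  the finite type \<open>'n\<close> indexes the free degrees of freedom, i.e. the shape functions spanning the
  finite element space; \<open>'d\<close> is the ambient Euclidean space of the domain.
\<close>

record ('d, 'e, 'n) topopt =
  Omega :: "'d set"
  GammaD :: "'d set"
  cell :: "'e \<Rightarrow> 'd set"
  shape :: "'n \<Rightarrow> 'd \<Rightarrow> real"
  source :: "'d \<Rightarrow> real"
  conductivity :: "real \<Rightarrow> real"
  kappa :: real
  pexp :: real
  nbhd :: "'e \<Rightarrow> 'e set"
  weight :: "'e \<Rightarrow> 'e \<Rightarrow> real"
  alpha :: real
  Vmax :: real

definition grad :: "('d::euclidean_space \<Rightarrow> real) \<Rightarrow> 'd \<Rightarrow> 'd" where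
  "grad g x = (THE D. GDERIV g x :> D)"

definition element_stiffness ::
    "('d::euclidean_space, 'e::finite, 'n::finite) topopt \<Rightarrow> 'e \<Rightarrow> real^'n^'n" where
  "element_stiffness P e =
     (\<chi> i j. LINT x:interior (cell P e)|lborel. grad (shape P i) x \<bullet> grad (shape P j) x)"

text \<open>
  Galerkin system of \<open>div (k(v) grad u) + F = 0\<close>. Testing with the \<open>i\<close>-th shape function and
  integrating by parts gives \<open>- \<integral> k(v) grad u \<bullet> grad N\<^sub>i + \<integral> F N\<^sub>i = 0\<close>: the boundary term
  vanishes on the Dirichlet part since \<open>N\<^sub>i = 0\<close> there, and on the Neumann part since the flux is
  zero. Hence the minus sign in the state matrix.
\<close>

definition state_matrix ::
    "('d::euclidean_space, 'e::finite, 'n::finite) topopt \<Rightarrow> real^'e \<Rightarrow> real^'n^'n" where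
  "state_matrix P v = - (\<Sum>e\<in>UNIV. conductivity P (v $ e) *\<^sub>R element_stiffness P e)"

definition load :: "('d::euclidean_space, 'e::finite, 'n::finite) topopt \<Rightarrow> real^'n" where
  "load P = (\<chi> i. LINT x:Omega P|lborel. source P x * shape P i x)"

definition state :: "('d::euclidean_space, 'e::finite, 'n::finite) topopt \<Rightarrow> real^'e \<Rightarrow> real^'n" where
  "state P v = (THE u. state_matrix P v *v u + load P = 0)"

definition fe_mesh :: "('d::euclidean_space, 'e::finite, 'n::finite) topopt \<Rightarrow> bool" where
  "fe_mesh P \<longleftrightarrow>
     open (Omega P) \<and> connected (Omega P) \<and> bounded (Omega P) \<and> Omega P \<noteq> {} \<and>
     GammaD P \<subseteq> frontier (Omega P) \<and>
     (\<forall>e. compact (cell P e) \<and> interior (cell P e) \<noteq> {} \<and> negligible (frontier (cell P e))) \<and>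
     (\<Union>e. cell P e) = closure (Omega P) \<and>
     (\<forall>e e'. e \<noteq> e' \<longrightarrow> interior (cell P e) \<inter> interior (cell P e') = {})"

definition fe_space :: "('d::euclidean_space, 'e::finite, 'n::finite) topopt \<Rightarrow> bool" where
  "fe_space P \<longleftrightarrow>
     (\<forall>i. continuous_on (closure (Omega P)) (shape P i) \<and>
          (\<forall>x\<in>GammaD P. shape P i x = 0) \<and>
          (\<forall>e. \<forall>x\<in>interior (cell P e). shape P i differentiable (at x)) \<and>
          (\<forall>e. set_integrable lborel (interior (cell P e)) (\<lambda>x. (norm (grad (shape P i) x))\<^sup>2)) \<and>
          set_integrable lborel (Omega P) (\<lambda>x. source P x * shape P i x))"

text \<open>
  For a real exponent the formula for \<open>k\<close> only makes sense for nonnegative densities. The values of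
  \<open>k\<close> at negative arguments (which the feasible set never uses, but over which the smoothness
  hypothesis on the Lagrangian ranges) are left arbitrary, so that no convention about powers of
  negative numbers is built in.
\<close>

definition topopt_problem :: "('d::euclidean_space, 'e::finite, 'n::finite) topopt \<Rightarrow> bool" where
  "topopt_problem P \<longleftrightarrow>
     fe_mesh P \<and> fe_space P \<and>
     0 < kappa P \<and> kappa P < 1 \<and> 1 \<le> pexp P \<and>
     (\<forall>t\<ge>0. conductivity P t = kappa P + (1 - kappa P) * t powr pexp P) \<and>
     (\<forall>v. invertible (state_matrix P v)) \<and>
     (\<forall>e. \<forall>e'\<in>nbhd P e. weight P e e' \<in> {1, sqrt 2}) \<and>
     0 < alpha P \<and> 0 \<le> Vmax P \<and> Vmax P \<le> 1"

definition compliance :: "('d::euclidean_space, 'e::finite, 'n::finite) topopt \<Rightarrow> real^'e \<Rightarrow> real" where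
  "compliance P v = load P \<bullet> state P v"

definition regularizer :: "('d::euclidean_space, 'e::finite, 'n::finite) topopt \<Rightarrow> real^'e \<Rightarrow> real" where
  "regularizer P w = alpha P * (\<Sum>e\<in>UNIV. \<Sum>e'\<in>nbhd P e. \<bar>w $ e - w $ e'\<bar> * weight P e e')"

definition aug_lagrangian ::
    "('d::euclidean_space, 'e::finite, 'n::finite) topopt \<Rightarrow> real \<Rightarrow>
     real^'e \<Rightarrow> real^'e \<Rightarrow> real^'e \<Rightarrow> real" where
  "aug_lagrangian P \<rho> v w lam =
     compliance P v + regularizer P w + lam \<bullet> (w - v) + \<rho> / 2 * (norm (w - v))\<^sup>2"

definition cont_feasible :: "('d::euclidean_space, 'e::finite, 'n::finite) topopt \<Rightarrow> (real^'e) set" where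
  "cont_feasible P =
     {v. (\<forall>e. v $ e \<in> {0..1}) \<and> (\<Sum>e\<in>UNIV. v $ e) \<le> Vmax P * real CARD('e)}"

definition disc_feasible :: "('d::euclidean_space, 'e::finite, 'n::finite) topopt \<Rightarrow> (real^'e) set" where
  "disc_feasible P =
     {w. (\<forall>e. w $ e \<in> {0, 1}) \<and> (\<Sum>e\<in>UNIV. w $ e) \<le> Vmax P * real CARD('e)}"

definition admm_step ::
    "('d::euclidean_space, 'e::finite, 'n::finite) topopt \<Rightarrow> real \<Rightarrow> real \<Rightarrow> real \<Rightarrow>
     real^'e \<Rightarrow> real^'e \<Rightarrow> real^'e \<Rightarrow> real \<Rightarrow> real \<Rightarrow>
     real^'e \<Rightarrow> real^'e \<Rightarrow> real^'e \<Rightarrow> real \<Rightarrow> real \<Rightarrow> bool" where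
  "admm_step P c \<beta> \<zeta> v w lam \<rho> \<tau> v' w' lam' \<rho>' \<tau>' \<longleftrightarrow>
     (\<exists>vs ws.
        is_arg_min (\<lambda>x. aug_lagrangian P \<rho> x w lam) (\<lambda>x. x \<in> cont_feasible P) vs \<and>
        is_arg_min (\<lambda>y. aug_lagrangian P \<rho> vs y lam) (\<lambda>y. y \<in> disc_feasible P) ws \<and>
        (if (norm (ws - vs))\<^sup>2 \<le> \<beta> * \<tau>
         then v' = vs \<and> w' = ws \<and> \<tau>' = (1 - \<zeta>) * \<tau> + \<zeta> * (norm (w' - v'))\<^sup>2 \<and>
              lam' = lam + \<rho> *\<^sub>R (w' - v') \<and> \<rho>' = \<rho>
         else v' = v \<and> w' = w \<and> \<tau>' = \<tau> \<and> lam' = lam \<and> \<rho>' = c * \<rho>))"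

definition admm_run ::
    "('d::euclidean_space, 'e::finite, 'n::finite) topopt \<Rightarrow> real \<Rightarrow> real \<Rightarrow> real \<Rightarrow> real \<Rightarrow>
     (nat \<Rightarrow> real^'e) \<Rightarrow> (nat \<Rightarrow> real^'e) \<Rightarrow> (nat \<Rightarrow> real^'e) \<Rightarrow> (nat \<Rightarrow> real) \<Rightarrow> (nat \<Rightarrow> real) \<Rightarrow> bool" where
  "admm_run P \<gamma> c \<beta> \<zeta> v w lam \<rho> \<tau> \<longleftrightarrow>
     v 0 \<in> cont_feasible P \<and> w 0 \<in> disc_feasible P \<and> 0 < \<rho> 0 \<and>
     \<tau> 0 = \<gamma> * max 1 ((norm (w 0 - v 0))\<^sup>2) \<and>
     (\<forall>j. admm_step P c \<beta> \<zeta> (v j) (w j) (lam j) (\<rho> j) (\<tau> j)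
            (v (Suc j)) (w (Suc j)) (lam (Suc j)) (\<rho> (Suc j)) (\<tau> (Suc j)))"

definition continuously_differentiable :: "('a::real_normed_vector \<Rightarrow> real) \<Rightarrow> bool" where
  "continuously_differentiable g \<longleftrightarrow>
     (\<exists>g' :: 'a \<Rightarrow> 'a \<Rightarrow>\<^sub>L real.
        (\<forall>x. (g has_derivative blinfun_apply (g' x)) (at x)) \<and> continuous_on UNIV g')"

end

theory Submission
  imports Defs
begin

text \<open>
  Everything reduces to showing that steps are accepted infinitely often: an accepted step
  contracts \<open>\<tau>\<close> by the factor \<open>1 - \<zeta> (1 - \<beta>)\<close>, so then \<open>\<tau>\<close> tends to \<open>0\<close> and the funnel
  condition forces the residual to \<open>0\<close>. Suppose instead that all steps after \<open>J\<close> are rejected.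
  Then \<open>v\<close>, \<open>w\<close>, \<open>\<lambda>\<close>, \<open>\<tau>\<close> are frozen while \<open>\<rho>\<close> grows geometrically. As the discrete feasible set
  lies in the continuous one, the frozen \<open>w\<close> is a competitor in both subproblems, so the trial pair
  satisfies \<open>\<L>\<^sub>\<rho> (v*, w*, \<lambda>) \<le> \<L>\<^sub>\<rho> (v*, w, \<lambda>) \<le> \<L>\<^sub>\<rho> (w, w, \<lambda>) = \<phi> w + \<psi> w\<close>, a bound
  independent of \<open>\<rho>\<close>. Hence \<open>w* - v*\<close> is arbitrarily small for large \<open>\<rho>\<close> and the step is accepted.
\<close>

text \<open>If the monotone limit \<open>L\<close> were positive, then \<open>L < L / q\<close>, so
  eventually \<open>t j < L / q\<close>. A single contraction from there lands strictly below
  \<open>L\<close>, which a decreasing sequence never does.\<close>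

lemma LIMSEQ_0_if_frequently_contracting:
  fixes t :: "nat \<Rightarrow> real"
  assumes "decseq t" and "\<And>j. 0 \<le> t j" and q: "0 < q" "q < 1"
    and contr: "\<exists>\<^sub>F j in sequentially. t (Suc j) \<le> q * t j"
  shows "t \<longlonglongrightarrow> 0"
proof -
  obtain L where L: "t \<longlonglongrightarrow> L" "\<And>j. L \<le> t j"
    using decseq_convergent[OF \<open>decseq t\<close>, of 0] assms(2) by blast
  have "0 \<le> L" using LIMSEQ_le_const[OF L(1)] assms(2) by blast
  moreover have "\<not> 0 < L"
  proof
    assume "0 < L"
    then have "L < L / q" using q by (simp add: field_simps)
    then have "\<forall>\<^sub>F j in sequentially. t j < L / q" using L(1) by (rule order_tendstoD(2)[rotated])
    then obtain j where "t (Suc j) \<le> q * t j" "t j < L / q"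
      using frequently_ex[OF frequently_eventually_frequently[OF contr]] by blast
    then have "t (Suc j) < L" using q by (simp add: field_simps)
    then show False using L(2)[of "Suc j"] by simp
  qed
  ultimately show ?thesis using L(1) by simp
qed

lemma incseq_bounded_or_at_top:
  fixes r :: "nat \<Rightarrow> real"
  assumes "incseq r"
  shows "(\<exists>b. \<forall>j. r j \<le> b) \<or> filterlim r at_top sequentially"
proof (rule disjCI)
  assume unb: "\<not> filterlim r at_top sequentially"
  then obtain b where b: "\<not> (\<forall>\<^sub>F j in sequentially. b \<le> r j)"
    by (auto simp: filterlim_at_top)
  have "r j \<le> b" for j
  proof (rule ccontr)
    assume "\<not> r j \<le> b"
    \<comment> \<open>Once a monotone sequence passes \<open>b\<close> it stays above it, so a level
      \<open>b\<close> not eventually reached is an upper bound.\<close>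
    then have "\<forall>k\<ge>j. b \<le> r k" using incseqD[OF assms, of j] by force
    with b show False by (auto simp: eventually_sequentially)
  qed
  then show "\<exists>b. \<forall>j. r j \<le> b" by blast
qed

lemma disc_feasible_subset_cont_feasible: "disc_feasible P \<subseteq> cont_feasible P"
proof
  fix w assume w: "w \<in> disc_feasible P"
  have "w $ e \<in> {0..1}" for e
  proof -
    have "w $ e \<in> {0, 1}" using w by (simp only: disc_feasible_def mem_Collect_eq)
    then show ?thesis by auto
  qed
  then show "w \<in> cont_feasible P" using w by (simp add: disc_feasible_def cont_feasible_def)
qed

lemma regularizer_nonneg:
  assumes "topopt_problem P"
  shows "0 \<le> regularizer P w"
proof -
  have "0 \<le> \<bar>w $ e - w $ e'\<bar> * weight P e e'" if "e' \<in> nbhd P e" for e e'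
  proof -
    have "weight P e e' \<in> {1, sqrt 2}" using assms that unfolding topopt_problem_def by blast
    then show ?thesis by auto
  qed
  moreover have "0 \<le> alpha P" using assms by (simp add: topopt_problem_def)
  ultimately show ?thesis
    unfolding regularizer_def by (intro mult_nonneg_nonneg[of "alpha P"] sum_nonneg) simp_all
qed

lemma continuously_differentiable_imp_continuous_on:
  assumes "continuously_differentiable g"
  shows "continuous_on S g"
  using assms unfolding continuously_differentiable_def
  by (meson continuous_at_imp_continuous_on has_derivative_continuous)

text \<open>Continuity of the compliance is read off from the smooth Lagrangian: at
  \<open>w = 0\<close>, \<open>lam = 0\<close> the two differ only by a constant and a multiple of
  the squared norm. The feasible set lies in the compact unit box.\<close>

lemma compliance_bdd_below:
  fixes P :: "('d::euclidean_space, 'e::finite, 'n::finite) topopt"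
  assumes "continuously_differentiable (\<lambda>x. aug_lagrangian P 1 x 0 0)"
  obtains m where "\<And>x. x \<in> cont_feasible P \<Longrightarrow> m \<le> compliance P x"
proof -
  let ?B = "cbox 0 1 :: (real^'e) set"
  have "compliance P = (\<lambda>x. aug_lagrangian P 1 x 0 0 - regularizer P 0 - 1 / 2 * (norm x)\<^sup>2)"
    by (simp add: aug_lagrangian_def fun_eq_iff)
  moreover have "continuous_on ?B \<dots>"
    by (intro continuous_intros continuously_differentiable_imp_continuous_on assms)
  ultimately have "compact (compliance P ` ?B)"
    by (simp add: compact_continuous_image compact_cbox)
  then have "bdd_below (compliance P ` ?B)"
    by (intro bounded_imp_bdd_below compact_imp_bounded)
  then obtain m where "\<And>x. x \<in> ?B \<Longrightarrow> m \<le> compliance P x" by (auto simp: bdd_below_def)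
  moreover have "cont_feasible P \<subseteq> ?B" by (auto simp: cont_feasible_def mem_box_cart)
  ultimately show thesis using that by blast
qed

lemma trial_pair_aug_lagrangian_le:
  assumes "is_arg_min (\<lambda>x. aug_lagrangian P r x w lam) (\<lambda>x. x \<in> cont_feasible P) vs"
    and "is_arg_min (\<lambda>y. aug_lagrangian P r vs y lam) (\<lambda>y. y \<in> disc_feasible P) ws"
    and "w \<in> disc_feasible P"
  shows "aug_lagrangian P r vs ws lam \<le> compliance P w + regularizer P w"
proof -
  have "aug_lagrangian P r vs ws lam \<le> aug_lagrangian P r vs w lam"
    using assms(2,3) by (auto simp: is_arg_min_linorder)
  also have "\<dots> \<le> aug_lagrangian P r w w lam"
    using assms(1,3) disc_feasible_subset_cont_feasible by (auto simp: is_arg_min_linorder)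
  also have "\<dots> = compliance P w + regularizer P w" by (simp add: aug_lagrangian_def)
  finally show ?thesis .
qed

text \<open>Divide by \<open>x\<^sup>2\<close>: both \<open>C / x\<^sup>2\<close> and
  \<open>l / x\<close> decrease in \<open>x\<close>, so the worst case is
  \<open>x = sqrt \<epsilon>\<close>. In the application \<open>x\<close> is the residual norm and
  \<open>l\<close> the norm of the multiplier.\<close>

lemma penalty_le_if_residual_ge:
  fixes r x C l \<epsilon> :: real
  assumes "0 < \<epsilon>" "\<epsilon> \<le> x\<^sup>2" "0 \<le> x" "0 \<le> C" "0 \<le> l" and le: "r / 2 * x\<^sup>2 \<le> C + l * x"
  shows "r \<le> 2 * (C / \<epsilon> + l / sqrt \<epsilon>)"
proof -
  have sx: "sqrt \<epsilon> \<le> x" using assms by (simp add: real_le_lsqrt)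
  have x: "0 < x" using sx \<open>0 < \<epsilon>\<close> by (smt (verit) real_sqrt_gt_zero)
  have "r / 2 \<le> (C + l * x) / x\<^sup>2" using le x by (simp add: pos_le_divide_eq)
  also have "\<dots> = C / x\<^sup>2 + l / x" using x by (simp add: field_simps power2_eq_square)
  also have "\<dots> \<le> C / \<epsilon> + l / sqrt \<epsilon>"
    using assms sx x by (intro add_mono divide_left_mono) auto
  finally show ?thesis by (simp only: pos_divide_le_eq zero_less_numeral mult.commute)
qed

text \<open>The point is the order of quantifiers: \<open>K\<close> depends on \<open>w\<close>,
  \<open>lam\<close> and \<epsilon>, but not on the penalty or the trial pair.\<close>

lemma rejected_penalty_bounded:
  fixes P :: "('d::euclidean_space, 'e::finite, 'n::finite) topopt"
  assumes P: "topopt_problem P"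
    and smooth: "continuously_differentiable (\<lambda>x. aug_lagrangian P 1 x 0 0)"
    and w: "w \<in> disc_feasible P" and "0 < \<epsilon>"
  obtains K where "\<And>r vs ws.
      is_arg_min (\<lambda>x. aug_lagrangian P r x w lam) (\<lambda>x. x \<in> cont_feasible P) vs \<Longrightarrow>
      is_arg_min (\<lambda>y. aug_lagrangian P r vs y lam) (\<lambda>y. y \<in> disc_feasible P) ws \<Longrightarrow>
      \<epsilon> \<le> (norm (ws - vs))\<^sup>2 \<Longrightarrow> r \<le> K"
proof -
  obtain m where m: "\<And>x. x \<in> cont_feasible P \<Longrightarrow> m \<le> compliance P x"
    using compliance_bdd_below[OF smooth] by blast
  \<comment> \<open>\<open>C\<close> is the gap between the upper bound on the Lagrangian of a trial
    pair and the lower bound \<open>m\<close> left after dropping the nonnegative regularizer. It is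
    nonnegative because \<open>w\<close> itself is feasible for the continuous subproblem.\<close>
  define C where "C = compliance P w + regularizer P w - m"
  have "0 \<le> C"
    using m[of w] w disc_feasible_subset_cont_feasible[of P] regularizer_nonneg[OF P, of w]
    by (auto simp: C_def)
  have "r \<le> 2 * (C / \<epsilon> + norm lam / sqrt \<epsilon>)"
    if v: "is_arg_min (\<lambda>x. aug_lagrangian P r x w lam) (\<lambda>x. x \<in> cont_feasible P) vs"
      and ws: "is_arg_min (\<lambda>y. aug_lagrangian P r vs y lam) (\<lambda>y. y \<in> disc_feasible P) ws"
      and "\<epsilon> \<le> (norm (ws - vs))\<^sup>2" for r vs ws
  proof (rule penalty_le_if_residual_ge)
    have "m \<le> compliance P vs" using m v by (auto simp: is_arg_min_def)
    moreover have "- (norm lam * norm (ws - vs)) \<le> lam \<bullet> (ws - vs)"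
      using Cauchy_Schwarz_ineq2[of lam "ws - vs"] by linarith
    ultimately show "r / 2 * (norm (ws - vs))\<^sup>2 \<le> C + norm lam * norm (ws - vs)"
      using trial_pair_aug_lagrangian_le[OF v ws w] regularizer_nonneg[OF P, of ws]
      by (simp add: C_def aug_lagrangian_def)
  qed (use that \<open>0 < \<epsilon>\<close> \<open>0 \<le> C\<close> in auto)
  then show thesis using that by blast
qed

theorem theorem1:
  fixes P :: "('d::euclidean_space, 'e::finite, 'n::finite) topopt"
    and \<gamma> c \<beta> \<zeta> :: real
    and v w lam :: "nat \<Rightarrow> real^'e"
    and \<rho> \<tau> :: "nat \<Rightarrow> real"
  assumes "topopt_problem P"
    and "1 < \<gamma>" and "1 < c" and "0 < \<beta>" and "\<beta> < 1" and "0 < \<zeta>" and "\<zeta> < 1"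
    and "admm_run P \<gamma> c \<beta> \<zeta> v w lam \<rho> \<tau>"
    and smooth: "\<And>wbar lbar r. 0 < r \<Longrightarrow>
           continuously_differentiable (\<lambda>x. aug_lagrangian P r x wbar lbar)"
    and lipschitz: "\<exists>Lv>0. \<forall>j.
           \<bar>aug_lagrangian P (\<rho> j) (v (Suc j)) (w j) (lam j)
             - aug_lagrangian P (\<rho> j) (v j) (w j) (lam j)\<bar>
           \<le> Lv * norm (v (Suc j) - v j)"
    and bounded: "bdd_below (range (\<lambda>j. aug_lagrangian P (\<rho> j) (v j) (w j) (lam j)))"
    and funnel: "\<And>j n. (norm (w (j + n) - v (j + n)))\<^sup>2 \<le> \<beta> * \<tau> j"
  shows "((\<exists>rbar. \<forall>j. \<rho> j \<le> rbar) \<or> filterlim \<rho> at_top sequentially) \<and>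
         (\<lambda>j. (norm (w j - v j))\<^sup>2) \<longlonglongrightarrow> 0"
proof -
  note P = assms(1) and c = assms(3) and par = assms(4-7) and run = assms(8)
  \<comment> \<open>\<open>acc\<close> and \<open>rej\<close> retain only the consequences of a step
    used below. For \<open>rej\<close> this includes the discarded trial pair, which the iterates no
    longer show.\<close>
  define acc where "acc j \<longleftrightarrow> \<tau> (Suc j) = (1 - \<zeta>) * \<tau> j + \<zeta> * (norm (w (Suc j) - v (Suc j)))\<^sup>2
      \<and> w (Suc j) \<in> disc_feasible P \<and> \<rho> (Suc j) = \<rho> j" for j
  define rej where "rej j \<longleftrightarrow> w (Suc j) = w j \<and> \<tau> (Suc j) = \<tau> j \<and> lam (Suc j) = lam j
      \<and> \<rho> (Suc j) = c * \<rho> j \<and> (\<exists>vs ws.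
        is_arg_min (\<lambda>x. aug_lagrangian P (\<rho> j) x (w j) (lam j)) (\<lambda>x. x \<in> cont_feasible P) vs \<and>
        is_arg_min (\<lambda>y. aug_lagrangian P (\<rho> j) vs y (lam j)) (\<lambda>y. y \<in> disc_feasible P) ws \<and>
        \<beta> * \<tau> j \<le> (norm (ws - vs))\<^sup>2)" for j
  have step: "acc j \<or> rej j" for j
  proof -
    have "admm_step P c \<beta> \<zeta> (v j) (w j) (lam j) (\<rho> j) (\<tau> j)
            (v (Suc j)) (w (Suc j)) (lam (Suc j)) (\<rho> (Suc j)) (\<tau> (Suc j))"
      using run by (simp add: admm_run_def)
    then obtain vs ws where
      vs: "is_arg_min (\<lambda>x. aug_lagrangian P (\<rho> j) x (w j) (lam j)) (\<lambda>x. x \<in> cont_feasible P) vs"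
      and ws: "is_arg_min (\<lambda>y. aug_lagrangian P (\<rho> j) vs y (lam j)) (\<lambda>y. y \<in> disc_feasible P) ws"
      and upd: "if (norm (ws - vs))\<^sup>2 \<le> \<beta> * \<tau> j
         then v (Suc j) = vs \<and> w (Suc j) = ws
              \<and> \<tau> (Suc j) = (1 - \<zeta>) * \<tau> j + \<zeta> * (norm (w (Suc j) - v (Suc j)))\<^sup>2
              \<and> lam (Suc j) = lam j + \<rho> j *\<^sub>R (w (Suc j) - v (Suc j)) \<and> \<rho> (Suc j) = \<rho> j
         else v (Suc j) = v j \<and> w (Suc j) = w j \<and> \<tau> (Suc j) = \<tau> j \<and> lam (Suc j) = lam j
              \<and> \<rho> (Suc j) = c * \<rho> j"
      unfolding admm_step_def by blast
    show ?thesis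
    proof (cases "(norm (ws - vs))\<^sup>2 \<le> \<beta> * \<tau> j")
      case True
      then have "acc j" using upd ws unfolding acc_def by (simp add: is_arg_min_def)
      then show ?thesis ..
    next
      case False
      then have "\<beta> * \<tau> j \<le> (norm (ws - vs))\<^sup>2" by simp
      with False have "rej j" using upd vs ws unfolding rej_def by (simp only: if_False) blast
      then show ?thesis ..
    qed
  qed
  have w: "w j \<in> disc_feasible P" for j
  proof (induction j)
    case 0
    then show ?case using run by (simp add: admm_run_def)
  next
    case (Suc j)
    then show ?case using step[of j] by (auto simp: acc_def rej_def)
  qed
  have \<rho>: "0 < \<rho> j" for j
  proof (induction j)
    case 0
    then show ?case using run by (simp add: admm_run_def)
  next
    case (Suc j)
    then show ?case using step[of j] c by (auto simp: acc_def rej_def)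
  qed
  have \<tau>: "0 < \<tau> j" for j
  proof (induction j)
    case 0
    then show ?case using run assms(2) by (simp add: admm_run_def)
  next
    case (Suc j)
    have "0 < (1 - \<zeta>) * \<tau> j" "0 \<le> \<zeta> * (norm (w (Suc j) - v (Suc j)))\<^sup>2" using Suc par by simp_all
    then show ?case using step[of j] Suc by (auto simp: acc_def rej_def)
  qed
  have "incseq \<rho>"
  proof (rule incseq_SucI)
    show "\<rho> j \<le> \<rho> (Suc j)" for j using step[of j] c \<rho>[of j] by (auto simp: acc_def rej_def)
  qed
  \<comment> \<open>Inserting a new squared residual of at most \<open>\<beta> * \<tau> j\<close>
    into the accepted update gives
    \<open>(1 - \<zeta>) * \<tau> j + \<zeta> * \<beta> * \<tau> j\<close>, which is
    \<open>q * \<tau> j\<close>.\<close>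
  define q where "q = 1 - \<zeta> * (1 - \<beta>)"
  have "0 < \<zeta> * (1 - \<beta>)" "\<zeta> * (1 - \<beta>) < 1 * 1"
    using par by (simp, intro mult_strict_mono, auto)
  then have q: "0 < q" "q < 1" by (simp_all add: q_def)
  have contr: "\<tau> (Suc j) \<le> q * \<tau> j" if "acc j" for j
  proof -
    \<comment> \<open>The shift \<open>n = 1\<close> in \<open>funnel\<close> compares the new
      residual with the old \<tau>.\<close>
    have "\<zeta> * (norm (w (Suc j) - v (Suc j)))\<^sup>2 \<le> \<zeta> * (\<beta> * \<tau> j)"
      using funnel[of j 1] par by (intro mult_left_mono) auto
    then show ?thesis using that by (simp add: acc_def q_def algebra_simps)
  qed
  have "decseq \<tau>"
  proof (rule decseq_SucI)
    fix j
    have "q * \<tau> j \<le> 1 * \<tau> j" using q \<tau>[of j] by (intro mult_right_mono) auto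
    then show "\<tau> (Suc j) \<le> \<tau> j" using step[of j] contr[of j] by (auto simp: rej_def)
  qed
  have "\<exists>\<^sub>F j in sequentially. acc j"
  proof (rule ccontr)
    assume "\<not> (\<exists>\<^sub>F j in sequentially. acc j)"
    then obtain J where "\<And>j. J \<le> j \<Longrightarrow> \<not> acc j"
      by (auto simp: not_frequently eventually_sequentially)
    then have rej: "rej (J + n)" for n using step[of "J + n"] by auto
    \<comment> \<open>The subproblems read only \<open>w\<close>, \<open>lam\<close> and \<rho>, so
      beyond \<open>J\<close> they differ in the penalty alone.\<close>
    have frozen: "w (J + n) = w J \<and> lam (J + n) = lam J \<and> \<tau> (J + n) = \<tau> J
        \<and> \<rho> (J + n) = c ^ n * \<rho> J" for n
    proof (induction n)
      case (Suc n)
      then show ?case using rej[of n] by (simp add: rej_def)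
    qed simp
    \<comment> \<open>Since \<tau> is frozen, the rejection threshold is one fixed positive number,
      and one \<open>K\<close> serves all later steps.\<close>
    have "0 < \<beta> * \<tau> J" using \<tau> par by simp
    then obtain K where K: "\<And>r vs ws.
        is_arg_min (\<lambda>x. aug_lagrangian P r x (w J) (lam J)) (\<lambda>x. x \<in> cont_feasible P) vs \<Longrightarrow>
        is_arg_min (\<lambda>y. aug_lagrangian P r vs y (lam J)) (\<lambda>y. y \<in> disc_feasible P) ws \<Longrightarrow>
        \<beta> * \<tau> J \<le> (norm (ws - vs))\<^sup>2 \<Longrightarrow> r \<le> K"
      using rejected_penalty_bounded[OF P smooth[of 1] w] by (metis zero_less_one)
    have "c ^ n * \<rho> J \<le> K" for n
      using rej[of n] frozen[of n] K unfolding rej_def by metis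
    moreover obtain n where "K / \<rho> J < c ^ n" using real_arch_pow[OF c] by blast
    ultimately show False using \<rho>[of J] by (simp add: pos_divide_less_eq leD)
  qed
  then have "\<exists>\<^sub>F j in sequentially. \<tau> (Suc j) \<le> q * \<tau> j"
    using contr by (rule frequently_elim1)
  with \<open>decseq \<tau>\<close> q have "\<tau> \<longlonglongrightarrow> 0"
    using \<tau> by (intro LIMSEQ_0_if_frequently_contracting) (auto intro: less_imp_le)
  then have "(\<lambda>j. \<beta> * \<tau> j) \<longlonglongrightarrow> 0" by (rule tendsto_mult_right_zero)
  then have "(\<lambda>j. (norm (w j - v j))\<^sup>2) \<longlonglongrightarrow> 0"
    \<comment> \<open>Here \<open>n = 0\<close> in \<open>funnel\<close> bounds each residual by the
      current \<tau>.\<close>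
    by (rule tendsto_sandwich[OF _ _ tendsto_const, rotated 2]) (use funnel[of _ 0] in auto)
  with incseq_bounded_or_at_top[OF \<open>incseq \<rho>\<close>] show ?thesis by blast
qed

end
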